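(* Let $\alpha'=\alpha=\beta=0$, $\beta'>0$ and $\gamma,\gamma'\ge0$ be real numbers, and let $X_n$ be the random variables associated with these parameters (see context), with mean $\mu_n=\mathbb{E}X_n$ and variance $\sigma_n^2=\operatorname{var}(X_n)$. If $\gamma>0$, then for every $n\ge 0$ the distribution of $X_n$ is that of a random variable $Y$ with the $\mathrm{NB}\left(1+\frac{\gamma'}{\beta'},\frac{\gamma}{\beta'+\gamma}\right)$ distribution conditioned on $Y+Z=n$, where $Z$ is a $\mathrm{Pois}\left(\frac{\gamma}{\beta'+\gamma}\right)$ random variable independent of $Y$; that is, $\mathbb{P}(X_n=k)=\mathbb{P}(Y=k\mid Y+Z=n)$ for $0\le k\le n$. Moreover, as $n\to\infty$, $$\mu_n=n-\frac{\gamma}{\beta'}(1+o(1)),\qquad \sigma_n^2=\frac{\gamma}{\beta'}(1+o(1)).$$ If $\gamma=0$, then $X_n=n$ almost surely.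
   Context: For real parameters $\alpha,\beta,\gamma,\alpha',\beta',\gamma'$, the numbers $\left|{n\atop k}\right|$, $0\le k\le n$, are defined by the recurrence $$\left|{n\atop k}\right|=(\alpha n+\beta k+\gamma)\left|{n-1\atop k}\right|+(\alpha' n+\beta' k+\gamma')\left|{n-1\atop k-1}\right|+I_{n=k=0},$$ with $\left|{n\atop k}\right|=0$ unless $0\le k\le n$; thus $\left|{0\atop 0}\right|=1$. The random variable $X_n$ is the integer-valued random variable with $$\mathbb{P}(X_n=k)=\frac{\left|{n\atop k}\right|}{\sum_{j=0}^n\left|{n\atop j}\right|},\qquad 0\le k\le n.$$ For real $r>0$ and $0<p<1$, a random variable $Y$ has the negative binomial distribution $\mathrm{NB}(r,p)$ if $$\mathbb{P}(Y=k)=\frac{\Gamma(k+r)}{k!\,\Gamma(r)}(1-p)^kp^r,\qquad k=0,1,2,\dots$$ $\mathrm{Pois}(\lambda)$ denotes the Poisson distribution with parameter $\lambda$. *)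

theory Defs
  imports "HOL-Probability.Probability"
begin

text \<open>
  The parameters are ordered \<open>\<alpha> \<beta> \<gamma> \<alpha>' \<beta>' \<gamma>'\<close>. The rows are computed for all \<open>k\<close>; that the
  entries vanish for \<open>k > n\<close> is a consequence (\<open>triangle_eq_0\<close>), and the absent entry \<open>k - 1\<close>
  for \<open>k = 0\<close> counts as zero.
\<close>

fun triangle :: "real \<Rightarrow> real \<Rightarrow> real \<Rightarrow> real \<Rightarrow> real \<Rightarrow> real \<Rightarrow> nat \<Rightarrow> nat \<Rightarrow> real" where
  "triangle \<alpha> \<beta> \<gamma> \<alpha>' \<beta>' \<gamma>' 0 k = (if k = 0 then 1 else 0)"
| "triangle \<alpha> \<beta> \<gamma> \<alpha>' \<beta>' \<gamma>' (Suc n) k =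
     (\<alpha> * real (Suc n) + \<beta> * real k + \<gamma>) * triangle \<alpha> \<beta> \<gamma> \<alpha>' \<beta>' \<gamma>' n k
     + (\<alpha>' * real (Suc n) + \<beta>' * real k + \<gamma>')
       * (if k = 0 then 0 else triangle \<alpha> \<beta> \<gamma> \<alpha>' \<beta>' \<gamma>' n (k - 1))"

lemma triangle_eq_0: "k > n \<Longrightarrow> triangle \<alpha> \<beta> \<gamma> \<alpha>' \<beta>' \<gamma>' n k = 0"
  by (induction n arbitrary: k) auto

definition has_triangle_law ::
    "'a measure \<Rightarrow> ('a \<Rightarrow> nat) \<Rightarrow> real \<Rightarrow> real \<Rightarrow> real \<Rightarrow> real \<Rightarrow> real \<Rightarrow> real \<Rightarrow> nat \<Rightarrow> bool" where
  "has_triangle_law M X \<alpha> \<beta> \<gamma> \<alpha>' \<beta>' \<gamma>' n \<longleftrightarrow>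
     X \<in> measurable M (count_space UNIV) \<and>
     (\<forall>k\<le>n. \<P>(\<omega> in M. X \<omega> = k) =
        triangle \<alpha> \<beta> \<gamma> \<alpha>' \<beta>' \<gamma>' n k / (\<Sum>j\<le>n. triangle \<alpha> \<beta> \<gamma> \<alpha>' \<beta>' \<gamma>' n j))"

text \<open>
  The library's \<open>neg_binomial_pmf\<close> only covers natural numbers \<open>r\<close>.
\<close>

definition has_neg_binomial_law :: "'a measure \<Rightarrow> ('a \<Rightarrow> nat) \<Rightarrow> real \<Rightarrow> real \<Rightarrow> bool" where
  "has_neg_binomial_law M Y r p \<longleftrightarrow>
     Y \<in> measurable M (count_space UNIV) \<and>
     (\<forall>k. \<P>(\<omega> in M. Y \<omega> = k) =
        Gamma (real k + r) / (fact k * Gamma r) * (1 - p) ^ k * p powr r)"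

definition has_poisson_law :: "'a measure \<Rightarrow> ('a \<Rightarrow> nat) \<Rightarrow> real \<Rightarrow> bool" where
  "has_poisson_law M Z rate \<longleftrightarrow>
     Z \<in> measurable M (count_space UNIV) \<and>
     distr M (count_space UNIV) Z = measure_pmf (poisson_pmf rate)"

text \<open>
  These laws are realised (for the triangle with \<open>\<alpha>' = \<alpha> = \<beta> = 0\<close>), so that hypotheses of this form
  are satisfiable.
\<close>

lemma triangle_law_exists:
  assumes "\<beta>' > 0" "\<gamma> \<ge> 0" "\<gamma>' \<ge> 0"
  shows "\<exists>q :: nat pmf. has_triangle_law (measure_pmf q) (\<lambda>k. k) 0 0 \<gamma> 0 \<beta>' \<gamma>' n"
proof -
  define T where "T = triangle 0 0 \<gamma> 0 \<beta>' \<gamma>'"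
  have T_nonneg: "T n k \<ge> 0" for n k
    unfolding T_def by (induction n arbitrary: k) (use assms in auto)
  have "T n n > 0"
    unfolding T_def by (induction n) (use assms in \<open>auto simp: triangle_eq_0 add_pos_nonneg\<close>)
  hence S: "(\<Sum>j\<le>n. T n j) > 0"
    by (intro sum_pos2[of _ n]) (auto simp: T_nonneg)
  define f where "f = (\<lambda>k. T n k / (\<Sum>j\<le>n. T n j))"
  have f_nonneg: "f k \<ge> 0" for k
    unfolding f_def using S T_nonneg by (intro divide_nonneg_nonneg) auto
  have "(\<integral>\<^sup>+k. ennreal (f k) \<partial>count_space UNIV) = (\<Sum>k\<le>n. ennreal (f k))"
    by (intro nn_integral_count_space'[OF finite_atMost])
       (auto simp: f_def T_def triangle_eq_0 not_le)
  also have "\<dots> = ennreal (\<Sum>k\<le>n. f k)"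
    by (intro sum_ennreal f_nonneg)
  also have "(\<Sum>k\<le>n. f k) = 1"
    using S by (simp add: f_def flip: sum_divide_distrib)
  finally have "pmf (embed_pmf f) k = f k" for k
    by (intro pmf_embed_pmf f_nonneg) auto
  thus ?thesis
    by (intro exI[of _ "embed_pmf f"])
       (auto simp: has_triangle_law_def f_def T_def pmf.rep_eq)
qed

lemma neg_binomial_law_exists:
  fixes r p :: real
  assumes "r > 0" "0 < p" "p < 1"
  shows "\<exists>q :: nat pmf. has_neg_binomial_law (measure_pmf q) (\<lambda>k. k) r p"
proof -
  define f where "f = (\<lambda>k::nat. Gamma (real k + r) / (fact k * Gamma r) * (1 - p) ^ k * p powr r)"
  have r: "r \<notin> \<int>\<^sub>\<le>\<^sub>0" using assms(1) by (auto elim!: nonpos_Ints_cases)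
  have f_nonneg: "f k \<ge> 0" for k
    unfolding f_def using assms by (intro mult_nonneg_nonneg divide_nonneg_nonneg) auto
  have f_eq: "f k = ((-r) gchoose k) * (- (1 - p)) ^ k * p powr r" for k
  proof -
    have "((-r) gchoose k) * (- (1 - p)) ^ k = pochhammer r k / fact k * ((-1) ^ k * (- (1 - p)) ^ k)"
      by (simp add: gbinomial_pochhammer)
    also have "(-1) ^ k * (- (1 - p)) ^ k = (1 - p) ^ k"
      by (simp flip: power_mult_distrib)
    finally show ?thesis
      by (simp add: f_def pochhammer_Gamma[OF r] add.commute)
  qed
  have "(\<lambda>k. ((-r) gchoose k) * (- (1 - p)) ^ k) sums (1 + (- (1 - p))) powr (-r)"
    by (rule gen_binomial_real) (use assms in auto)
  from sums_mult2[OF this, of "p powr r"] have sums: "f sums 1"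
    using assms by (simp add: f_eq[abs_def] powr_minus)
  have "(\<integral>\<^sup>+k. ennreal (f k) \<partial>count_space UNIV) = (\<Sum>k. ennreal (f k))"
    by (rule nn_integral_count_space_nat)
  also have "\<dots> = 1"
    using suminf_ennreal_eq[OF f_nonneg sums] by simp
  finally have "pmf (embed_pmf f) k = f k" for k
    by (intro pmf_embed_pmf f_nonneg)
  thus ?thesis
    by (intro exI[of _ "embed_pmf f"])
       (auto simp: has_neg_binomial_law_def f_def pmf.rep_eq)
qed

lemma neg_binomial_poisson_indep_exists:
  fixes r p rate :: real
  assumes "r > 0" "0 < p" "p < 1" "rate > 0"
  shows "\<exists>(N :: (nat \<times> nat) measure) Y Z. prob_space N \<and> has_neg_binomial_law N Y r p \<and>
           has_poisson_law N Z rate \<and>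
           prob_space.indep_var N (count_space UNIV) Y (count_space UNIV) Z"
proof -
  obtain q :: "nat pmf" where q: "has_neg_binomial_law (measure_pmf q) (\<lambda>k. k) r p"
    using neg_binomial_law_exists[OF assms(1-3)] by blast
  define N where "N = pair_pmf q (poisson_pmf rate)"
  have fst: "distr (measure_pmf N) (count_space UNIV) fst = measure_pmf q"
    by (simp add: N_def map_fst_pair_pmf flip: map_pmf_rep_eq)
  have snd: "distr (measure_pmf N) (count_space UNIV) snd = measure_pmf (poisson_pmf rate)"
    by (simp add: N_def map_snd_pair_pmf flip: map_pmf_rep_eq)
  have "\<P>(\<omega> in measure_pmf N. fst \<omega> = k) = \<P>(\<omega> in measure_pmf q. \<omega> = k)" for k
    unfolding fst[symmetric] by (subst measure_distr) (auto simp: vimage_def)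
  hence Y: "has_neg_binomial_law (measure_pmf N) fst r p"
    using q by (simp add: has_neg_binomial_law_def)
  have Z: "has_poisson_law (measure_pmf N) snd rate"
    using snd by (simp add: has_poisson_law_def)
  have sets_prod: "sets (count_space UNIV \<Otimes>\<^sub>M count_space UNIV :: (nat \<times> nat) measure) = UNIV"
    by (subst pair_measure_countable) auto
  have prod: "measure_pmf N = measure_pmf q \<Otimes>\<^sub>M measure_pmf (poisson_pmf rate)" (is "_ = ?P")
  proof (rule measure_eqI_countable[where A = UNIV])
    show "sets ?P = Pow UNIV"
      by (simp add: sets_pair_measure_cong[OF sets_measure_pmf_count_space sets_measure_pmf_count_space]
            sets_prod)
  next
    fix x :: "nat \<times> nat"
    obtain a b where x: "x = (a, b)" by (cases x)
    have "emeasure ?P ({a} \<times> {b}) = emeasure (measure_pmf q) {a} * emeasure (poisson_pmf rate) {b}"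
      by (rule measure_pmf.emeasure_pair_measure_Times) auto
    thus "emeasure (measure_pmf N) {x} = emeasure ?P {x}"
      by (simp add: x N_def emeasure_pmf_single pmf_pair ennreal_mult)
  qed auto
  have joint: "distr (measure_pmf N) (count_space UNIV \<Otimes>\<^sub>M count_space UNIV) (\<lambda>x. (fst x, snd x))
      = measure_pmf N"
    using distr_id2[of "count_space UNIV \<Otimes>\<^sub>M count_space UNIV" "measure_pmf N"]
    by (simp add: sets_prod id_def)
  have "prob_space.indep_var (measure_pmf N) (count_space UNIV) fst (count_space UNIV) snd"
    unfolding prob_space.indep_var_distribution_eq[OF prob_space_measure_pmf] fst snd joint
    using prod by simp
  thus ?thesis
    using Y Z prob_space_measure_pmf by blast
qed

end

theory Submission
  imports Defs
begin

text \<open>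
  For \<open>\<alpha>' = \<alpha> = \<beta> = 0\<close> the recurrence is solved by
  \<open>T n k = (n choose k) \<gamma>\<^sup>n\<^sup>-\<^sup>k (\<beta>' + \<gamma>') (2\<beta>' + \<gamma>') \<dots> (k\<beta>' + \<gamma>')\<close>, which is proportional in \<open>k\<close> to the
  product of the negative binomial weight of \<open>k\<close> and the Poisson weight of \<open>n - k\<close>. The closed form
  gives \<open>(n + 1 - k) T (n + 1) k = (n + 1) \<gamma> T n k\<close>, so the factorial moments of \<open>W\<^sub>n = n - X\<^sub>n\<close>
  are governed by the row sums alone: with \<open>x n = \<E> W\<^sub>n\<close> one has \<open>\<E> W\<^sub>n (W\<^sub>n - 1) = x n \<cdot> x (n - 1)\<close>. Summing
  the recurrence over a row yields
  \<open>x (n + 1) = (n + 1) \<gamma> / (\<beta>' (n + 1) + \<gamma>' + \<gamma> - \<beta>' x n)\<close>, which keeps \<open>x\<close> inside \<open>[0, \<gamma> / \<beta>']\<close> and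
  then squeezes it to \<open>\<gamma> / \<beta>'\<close>.
\<close>

section \<open>Row sums, closed form and absorption identity\<close>

definition row_sum :: "real \<Rightarrow> real \<Rightarrow> real \<Rightarrow> nat \<Rightarrow> real" where
  "row_sum g b c n = (\<Sum>k\<le>n. triangle 0 0 g 0 b c n k)"

text \<open>This is the expectation of \<open>n - X\<close> under the normalised row, written as a
  finite sum so that its asymptotics can be studied without a probability space.\<close>

definition mean_deficit :: "real \<Rightarrow> real \<Rightarrow> real \<Rightarrow> nat \<Rightarrow> real" where
  "mean_deficit g b c n = (\<Sum>k\<le>n. real (n - k) * triangle 0 0 g 0 b c n k) / row_sum g b c n"

text \<open>Both terms of the recurrence carry the same power of \<open>g\<close> and the same
  product, so their binomial coefficients add up by Pascal's rule. For \<open>k > n\<close> the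
  binomial coefficient vanishes, so the formula holds for every \<open>k\<close>.\<close>

lemma triangle_closed_form:
  "triangle 0 0 g 0 b c n k = real (n choose k) * g ^ (n - k) * (\<Prod>i=1..k. b * real i + c)"
proof (induction n arbitrary: k)
  case 0
  show ?case by (cases k) auto
next
  case (Suc n)
  show ?case
  proof (cases k)
    case 0
    then show ?thesis by (simp add: Suc.IH)
  next
    case (Suc j)
    \<comment> \<open>The exponent \<open>n - Suc j\<close> is truncated once
      \<open>j \<ge> n\<close>, but there the term carries the factor \<open>n choose Suc j\<close>,
      which is zero.\<close>
    show ?thesis
    proof (cases "j < n")
      case True
      then have "n - j = Suc (n - Suc j)" by simp
      then show ?thesis
        using Suc by (simp add: Suc.IH algebra_simps)
    next
      case False
      then show ?thesis
        using Suc by (simp add: Suc.IH binomial_eq_0)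
    qed
  qed
qed

lemma triangle_nonneg:
  assumes "b > 0" "g \<ge> 0" "c \<ge> 0"
  shows "triangle 0 0 g 0 b c n k \<ge> 0"
  unfolding triangle_closed_form using assms by (intro mult_nonneg_nonneg prod_nonneg) auto

lemma triangle_diag_pos:
  assumes "b > 0" "c \<ge> 0"
  shows "triangle 0 0 g 0 b c n n > 0"
  unfolding triangle_closed_form using assms by (auto intro!: prod_pos add_pos_nonneg)

lemma row_sum_pos:
  assumes "b > 0" "g \<ge> 0" "c \<ge> 0"
  shows "row_sum g b c n > 0"
  unfolding row_sum_def
  by (rule sum_pos2[of _ n]) (use assms triangle_nonneg triangle_diag_pos in auto)

text \<open>The closed form reduces this to
  \<open>(n + 1 - k) * (n + 1 choose k) = (n + 1) * (n choose k)\<close>; the product over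
  \<open>i\<close> is common to both sides and the exponent of \<open>g\<close> differs by
  one.\<close>

lemma triangle_absorb:
  "real (Suc n - k) * triangle 0 0 g 0 b c (Suc n) k = real (Suc n) * g * triangle 0 0 g 0 b c n k"
proof (cases "k \<le> n")
  case True
  have "(Suc n - k) * (Suc n choose k) = Suc n * (n choose k)"
    using binomial_absorb_comp[of "Suc n" k] by simp
  then have "real (Suc n - k) * real (Suc n choose k) = real (Suc n) * real (n choose k)"
    by (metis of_nat_mult)
  moreover have "Suc n - k = Suc (n - k)"
    using True by simp
  ultimately show ?thesis
    unfolding triangle_closed_form by (simp add: algebra_simps del: of_nat_Suc)
next
  case False
  then show ?thesis by (simp add: triangle_eq_0 del: triangle.simps)
qed

text \<open>Absorption under a weight \<open>f\<close>: the constant weight gives the mean deficit,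
  the weight "deficit minus one" the second factorial moment. The top index drops out because
  \<open>triangle\<close> vanishes at \<open>k = Suc n\<close> in row \<open>n\<close>.\<close>

lemma sum_deficit_triangle_Suc:
  "(\<Sum>k\<le>Suc n. real (Suc n - k) * f k * triangle 0 0 g 0 b c (Suc n) k)
     = real (Suc n) * g * (\<Sum>k\<le>n. f k * triangle 0 0 g 0 b c n k)"
proof -
  have "real (Suc n - k) * f k * triangle 0 0 g 0 b c (Suc n) k
      = real (Suc n) * g * (f k * triangle 0 0 g 0 b c n k)" for k
    using triangle_absorb[of n k g b c] by (metis mult.assoc mult.commute)
  then have "(\<Sum>k\<le>Suc n. real (Suc n - k) * f k * triangle 0 0 g 0 b c (Suc n) k)
      = (\<Sum>k\<le>Suc n. real (Suc n) * g * (f k * triangle 0 0 g 0 b c n k))"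
    by (intro sum.cong refl)
  then show ?thesis
    by (simp add: sum_distrib_left triangle_eq_0 del: triangle.simps of_nat_Suc)
qed

text \<open>After an index shift, entry \<open>k\<close> of row \<open>n\<close> enters the next row
  sum with weight \<open>g + b * (k + 1) + c\<close>. Writing
  \<open>k + 1 = (n + 1) - (n - k)\<close> isolates the deficit.\<close>

lemma row_sum_Suc:
  "row_sum g b c (Suc n) = (g + b * real (Suc n) + c) * row_sum g b c n
     - b * (\<Sum>k\<le>n. real (n - k) * triangle 0 0 g 0 b c n k)"
proof -
  have "row_sum g b c (Suc n) =
      g * (\<Sum>k\<le>Suc n. triangle 0 0 g 0 b c n k)
      + (\<Sum>k\<le>Suc n. (b * real k + c) * (if k = 0 then 0 else triangle 0 0 g 0 b c n (k - 1)))"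
    by (simp add: row_sum_def sum.distrib sum_distrib_left del: sum.atMost_Suc)
  also have "(\<Sum>k\<le>Suc n. triangle 0 0 g 0 b c n k) = row_sum g b c n"
    by (simp add: row_sum_def triangle_eq_0)
  also have "(\<Sum>k\<le>Suc n. (b * real k + c) * (if k = 0 then 0 else triangle 0 0 g 0 b c n (k - 1)))
      = (\<Sum>k\<le>n. (b * real (Suc k) + c) * triangle 0 0 g 0 b c n k)"
    by (subst sum.atMost_Suc_shift) simp
  also have "\<dots> = (\<Sum>k\<le>n. (b * real (Suc n) + c) * triangle 0 0 g 0 b c n k
      - b * (real (n - k) * triangle 0 0 g 0 b c n k))"
    by (intro sum.cong) (auto simp: of_nat_diff algebra_simps)
  also have "\<dots> = (b * real (Suc n) + c) * row_sum g b c n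
      - b * (\<Sum>k\<le>n. real (n - k) * triangle 0 0 g 0 b c n k)"
    by (simp add: sum_subtractf sum_distrib_left row_sum_def del: of_nat_Suc)
  finally show ?thesis by (simp add: algebra_simps)
qed

section \<open>Recurrence, bounds and limit of the mean deficit\<close>

lemma mean_deficit_0 [simp]: "mean_deficit g b c 0 = 0"
  by (simp add: mean_deficit_def)

lemma mean_deficit_Suc_row_sum:
  "mean_deficit g b c (Suc n) = real (Suc n) * g * row_sum g b c n / row_sum g b c (Suc n)"
  using sum_deficit_triangle_Suc[of n "\<lambda>_. 1" g b c]
  by (simp add: mean_deficit_def row_sum_def del: triangle.simps of_nat_Suc sum.atMost_Suc)

text \<open>By \<open>row_sum_Suc\<close>, the denominator is the ratio of consecutive row
  sums.\<close>

lemma mean_deficit_Suc: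
  assumes "b > 0" "g \<ge> 0" "c \<ge> 0"
  shows "mean_deficit g b c (Suc n)
    = real (Suc n) * g / (b * real (Suc n) + c + (g - b * mean_deficit g b c n))"
proof -
  have pos: "row_sum g b c n > 0"
    using row_sum_pos[OF assms] .
  then have "row_sum g b c (Suc n)
      = (b * real (Suc n) + c + (g - b * mean_deficit g b c n)) * row_sum g b c n"
    unfolding row_sum_Suc by (simp add: mean_deficit_def field_simps)
  then show ?thesis
    using pos by (simp add: mean_deficit_Suc_row_sum)
qed

text \<open>The upper bound reproduces itself: if \<open>b * mean_deficit g b c n \<le> g\<close>,
  the denominator in \<open>mean_deficit_Suc\<close> is at least \<open>b * (n + 1)\<close>, so the
  next value is at most \<open>g / b\<close>.\<close>

lemma mean_deficit_bounds:
  assumes "b > 0" "g \<ge> 0" "c \<ge> 0"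
  shows "0 \<le> mean_deficit g b c n \<and> b * mean_deficit g b c n \<le> g"
proof (induction n)
  case 0
  then show ?case using assms by simp
next
  case (Suc n)
  define d where "d = b * real (Suc n) + c + (g - b * mean_deficit g b c n)"
  have "d \<ge> b * real (Suc n)" "d > 0"
    using Suc assms by (auto simp: d_def add_pos_nonneg intro!: add_pos_nonneg)
  moreover have "mean_deficit g b c (Suc n) = real (Suc n) * g / d"
    unfolding d_def by (rule mean_deficit_Suc[OF assms])
  ultimately show ?case
    using assms mult_right_mono[of "b * real (Suc n)" d g]
    by (auto simp: divide_le_eq mult_ac simp del: of_nat_Suc)
qed

lemma mean_deficit_tendsto:
  assumes "b > 0" "g \<ge> 0" "c \<ge> 0"
  shows "mean_deficit g b c \<longlonglongrightarrow> g / b"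
proof -
  \<comment> \<open>Nonnegativity of the previous mean deficit bounds the denominator from
    above.\<close>
  have lower: "real (Suc n) * g / (b * real (Suc n) + c + g) \<le> mean_deficit g b c (Suc n)" for n
    unfolding mean_deficit_Suc[OF assms]
    using mean_deficit_bounds[OF assms, of n] assms
    by (intro divide_left_mono mult_pos_pos add_pos_nonneg) auto
  have upper: "mean_deficit g b c (Suc n) \<le> g / b" for n
    using mean_deficit_bounds[OF assms, of "Suc n"] assms by (simp add: field_simps)
  have "(\<lambda>n. g / (b + (c + g) * inverse (real (Suc n)))) \<longlonglongrightarrow> g / (b + (c + g) * 0)"
    using assms by (intro tendsto_intros LIMSEQ_inverse_real_of_nat) auto
  moreover have "g / (b + (c + g) * inverse (real (Suc n)))
      = real (Suc n) * g / (b * real (Suc n) + c + g)" for n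
    using assms by (simp add: divide_simps)
  ultimately have "(\<lambda>n. real (Suc n) * g / (b * real (Suc n) + c + g)) \<longlonglongrightarrow> g / b"
    by simp
  then have "(\<lambda>n. mean_deficit g b c (Suc n)) \<longlonglongrightarrow> g / b"
    by (rule real_tendsto_sandwich[rotated 2, OF _ tendsto_const]) (use lower upper in auto)
  then show ?thesis
    by (rule LIMSEQ_imp_Suc)
qed

text \<open>For \<open>n = 0\<close> both sides vanish, as \<open>mean_deficit g b c 0 = 0\<close>.\<close>

lemma second_factorial_deficit:
  assumes "b > 0" "g \<ge> 0" "c \<ge> 0"
  shows "(\<Sum>k\<le>n. real (n - k) * (real (n - k) - 1) * triangle 0 0 g 0 b c n k) / row_sum g b c n
    = mean_deficit g b c n * mean_deficit g b c (n - 1)"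
proof (cases n)
  case 0
  then show ?thesis by simp
next
  case (Suc m)
  have "(\<Sum>k\<le>Suc m. real (Suc m - k) * (real (Suc m - k) - 1) * triangle 0 0 g 0 b c (Suc m) k)
      = real (Suc m) * g * (\<Sum>k\<le>m. (real (Suc m - k) - 1) * triangle 0 0 g 0 b c m k)"
    by (rule sum_deficit_triangle_Suc)
  \<comment> \<open>In the range \<open>k \<le> m\<close>, lowering the deficit by one gives exactly
    the deficit in row \<open>m\<close>; this is how the previous mean enters.\<close>
  also have "(\<Sum>k\<le>m. (real (Suc m - k) - 1) * triangle 0 0 g 0 b c m k)
      = (\<Sum>k\<le>m. real (m - k) * triangle 0 0 g 0 b c m k)"
    by (intro sum.cong) (auto simp: Suc_diff_le)
  also have "\<dots> = mean_deficit g b c m * row_sum g b c m"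
    using row_sum_pos[OF assms, of m] by (simp add: mean_deficit_def)
  finally show ?thesis
    by (simp add: Suc mean_deficit_Suc_row_sum mult_ac del: triangle.simps sum.atMost_Suc of_nat_Suc)
qed

section \<open>Finite-range expectations, sums of independent variables and support\<close>

context prob_space
begin

text \<open>Almost surely \<open>f (X \<omega>)\<close> is a finite combination of indicators of
  events, so integrability comes for free.\<close>

lemma expectation_finite_nat_range:
  fixes X :: "'a \<Rightarrow> nat" and f :: "nat \<Rightarrow> real"
  assumes [measurable]: "X \<in> measurable M (count_space UNIV)"
    and "AE \<omega> in M. X \<omega> \<le> n"
  shows "expectation (\<lambda>\<omega>. f (X \<omega>)) = (\<Sum>k\<le>n. f k * \<P>(\<omega> in M. X \<omega> = k))"
proof -
  have ev: "{\<omega> \<in> space M. X \<omega> = k} \<in> events" for k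
    by measurable
  have "expectation (\<lambda>\<omega>. f (X \<omega>))
      = expectation (\<lambda>\<omega>. \<Sum>k\<le>n. f k * indicator {\<omega> \<in> space M. X \<omega> = k} \<omega>)"
  proof (rule integral_cong_AE)
    show "AE \<omega> in M. f (X \<omega>) = (\<Sum>k\<le>n. f k * indicator {\<omega> \<in> space M. X \<omega> = k} \<omega>)"
      using assms(2) AE_space
    proof eventually_elim
      case (elim \<omega>)
      then have "(\<Sum>k\<le>n. f k * indicator {\<omega> \<in> space M. X \<omega> = k} \<omega>)
          = (\<Sum>k\<le>n. if k = X \<omega> then f k else 0)"
        by (intro sum.cong) (auto simp: indicator_def)
      then show ?case using elim by simp
    qed
  qed measurable
  also have "\<dots> = (\<Sum>k\<le>n. f k * \<P>(\<omega> in M. X \<omega> = k))"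
    using ev by (subst Bochner_Integration.integral_sum) (auto simp: emeasure_eq_measure)
  finally show ?thesis .
qed

text \<open>The event says that \<open>(Y, Z)\<close> lies in the rectangle
  \<open>{k} \<times> {n - k}\<close>; \<open>k \<le> n\<close> keeps the subtraction exact.\<close>

lemma prob_nat_add_eq:
  fixes Y Z :: "'a \<Rightarrow> nat"
  assumes ind: "indep_var (count_space UNIV) Y (count_space UNIV) Z" and "k \<le> n"
  shows "\<P>(\<omega> in M. Y \<omega> = k \<and> Y \<omega> + Z \<omega> = n)
    = \<P>(\<omega> in M. Y \<omega> = k) * \<P>(\<omega> in M. Z \<omega> = n - k)"
proof -
  have "{\<omega> \<in> space M. Y \<omega> = k \<and> Y \<omega> + Z \<omega> = n}
      = ((\<lambda>\<omega>. (Y \<omega>, Z \<omega>)) -` ({k} \<times> {n - k}) \<inter> space M)"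
    using assms(2) by auto
  moreover have "(\<lambda>\<omega>. Y \<omega>) -` {k} \<inter> space M = {\<omega> \<in> space M. Y \<omega> = k}"
    "(\<lambda>\<omega>. Z \<omega>) -` {n - k} \<inter> space M = {\<omega> \<in> space M. Z \<omega> = n - k}"
    by auto
  ultimately show ?thesis
    using indep_varD[OF ind, of "{k}" "{n - k}"] by simp
qed

lemma cond_prob_nat_add:
  fixes Y Z :: "'a \<Rightarrow> nat"
  assumes ind: "indep_var (count_space UNIV) Y (count_space UNIV) Z" and k: "k \<le> n"
  shows "\<P>(\<omega> in M. Y \<omega> = k \<bar> Y \<omega> + Z \<omega> = n)
    = \<P>(\<omega> in M. Y \<omega> = k) * \<P>(\<omega> in M. Z \<omega> = n - k)
      / (\<Sum>j\<le>n. \<P>(\<omega> in M. Y \<omega> = j) * \<P>(\<omega> in M. Z \<omega> = n - j))"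
proof -
  have [measurable]: "Y \<in> measurable M (count_space UNIV)" "Z \<in> measurable M (count_space UNIV)"
    using indep_var_rv1[OF ind] indep_var_rv2[OF ind] .
  have "{\<omega> \<in> space M. Y \<omega> + Z \<omega> = n} = (\<Union>j\<le>n. {\<omega> \<in> space M. Y \<omega> = j \<and> Y \<omega> + Z \<omega> = n})"
    by auto
  also have "prob \<dots> = (\<Sum>j\<le>n. \<P>(\<omega> in M. Y \<omega> = j \<and> Y \<omega> + Z \<omega> = n))"
    by (intro finite_measure_finite_Union) (auto simp: disjoint_family_on_def)
  also have "\<dots> = (\<Sum>j\<le>n. \<P>(\<omega> in M. Y \<omega> = j) * \<P>(\<omega> in M. Z \<omega> = n - j))"
    by (intro sum.cong refl prob_nat_add_eq[OF ind]) auto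
  finally show ?thesis
    unfolding cond_prob_def prob_nat_add_eq[OF ind k] by simp
qed

lemma poisson_law_prob:
  assumes "has_poisson_law M Z rate" "rate > 0"
  shows "\<P>(\<omega> in M. Z \<omega> = k) = rate ^ k / fact k * exp (- rate)"
proof -
  have [measurable]: "Z \<in> measurable M (count_space UNIV)"
    and d: "distr M (count_space UNIV) Z = measure_pmf (poisson_pmf rate)"
    using assms by (auto simp: has_poisson_law_def)
  have "\<P>(\<omega> in M. Z \<omega> = k) = measure (distr M (count_space UNIV) Z) {k}"
    by (subst measure_distr) (auto simp: vimage_def Int_def conj_commute)
  also have "\<dots> = pmf (poisson_pmf rate) k"
    by (simp add: d pmf.rep_eq)
  finally show ?thesis
    using assms(2) by simp
qed

text \<open>\<open>has_triangle_law\<close> prescribes probabilities only for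
  \<open>k \<le> n\<close>. They already sum to 1, which leaves no mass above
  \<open>n\<close>.\<close>

lemma triangle_law_AE_le:
  assumes law: "has_triangle_law M X 0 0 g 0 b c n" and "b > 0" "g \<ge> 0" "c \<ge> 0"
  shows "AE \<omega> in M. X \<omega> \<le> n"
proof -
  have [measurable]: "X \<in> measurable M (count_space UNIV)"
    and p: "\<And>k. k \<le> n \<Longrightarrow> \<P>(\<omega> in M. X \<omega> = k) = triangle 0 0 g 0 b c n k / row_sum g b c n"
    using law by (auto simp: has_triangle_law_def row_sum_def)
  have "{\<omega> \<in> space M. X \<omega> \<le> n} = (\<Union>k\<le>n. {\<omega> \<in> space M. X \<omega> = k})"
    by auto
  also have "prob \<dots> = (\<Sum>k\<le>n. \<P>(\<omega> in M. X \<omega> = k))"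
    by (intro finite_measure_finite_Union) (auto simp: disjoint_family_on_def)
  also have "\<dots> = row_sum g b c n / row_sum g b c n"
    using p by (simp add: row_sum_def flip: sum_divide_distrib)
  also have "\<dots> = 1"
    using row_sum_pos[OF assms(2-4), of n] by simp
  finally show ?thesis
    by (subst (asm) prob_Collect_eq_1) auto
qed

section \<open>Mean, variance and the degenerate case\<close>

lemma triangle_law_expectation:
  assumes law: "has_triangle_law M X 0 0 g 0 b c n" and "b > 0" "g \<ge> 0" "c \<ge> 0"
  shows "expectation (\<lambda>\<omega>. f (X \<omega>)) = (\<Sum>k\<le>n. f k * triangle 0 0 g 0 b c n k) / row_sum g b c n"
proof -
  have "expectation (\<lambda>\<omega>. f (X \<omega>)) = (\<Sum>k\<le>n. f k * \<P>(\<omega> in M. X \<omega> = k))"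
    using law by (intro expectation_finite_nat_range triangle_law_AE_le[OF assms])
      (auto simp: has_triangle_law_def)
  also have "\<dots> = (\<Sum>k\<le>n. f k * triangle 0 0 g 0 b c n k) / row_sum g b c n"
    using law by (simp add: has_triangle_law_def row_sum_def sum_divide_distrib)
  finally show ?thesis .
qed

lemma triangle_law_mean:
  assumes "has_triangle_law M X 0 0 g 0 b c n" and "b > 0" "g \<ge> 0" "c \<ge> 0"
  shows "expectation (\<lambda>\<omega>. real (X \<omega>)) = real n - mean_deficit g b c n"
proof -
  have "(\<Sum>k\<le>n. real k * triangle 0 0 g 0 b c n k)
      = (\<Sum>k\<le>n. real n * triangle 0 0 g 0 b c n k - real (n - k) * triangle 0 0 g 0 b c n k)"
    by (intro sum.cong) (auto simp: of_nat_diff algebra_simps)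
  also have "\<dots> = real n * row_sum g b c n - (\<Sum>k\<le>n. real (n - k) * triangle 0 0 g 0 b c n k)"
    by (simp add: sum_subtractf sum_distrib_left row_sum_def)
  finally show ?thesis
    using row_sum_pos[OF assms(2-4), of n] triangle_law_expectation[OF assms, of real]
    by (simp add: mean_deficit_def diff_divide_distrib)
qed

lemma triangle_law_variance:
  assumes "has_triangle_law M X 0 0 g 0 b c n" and "b > 0" "g \<ge> 0" "c \<ge> 0"
  shows "variance (\<lambda>\<omega>. real (X \<omega>))
    = mean_deficit g b c n * mean_deficit g b c (n - 1) + mean_deficit g b c n
      - (mean_deficit g b c n)\<^sup>2"
proof -
  define x where "x = mean_deficit g b c n"
  define R where "R = row_sum g b c n"
  define T where "T = triangle 0 0 g 0 b c n"
  have R: "R > 0"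
    unfolding R_def by (rule row_sum_pos[OF assms(2-4)])
  have "variance (\<lambda>\<omega>. real (X \<omega>)) = (\<Sum>k\<le>n. (real k - (real n - x))\<^sup>2 * T k) / R"
    unfolding triangle_law_mean[OF assms] x_def R_def T_def
    by (rule triangle_law_expectation[OF assms, of "\<lambda>k. (real k - (real n - mean_deficit g b c n))\<^sup>2"])
  \<comment> \<open>With \<open>w = n - k\<close>, the square is
    \<open>(x - w)^2 = w * (w - 1) + (1 - 2 * x) * w + x^2\<close>, which brings in the factorial
    moments.\<close>
  also have "(\<Sum>k\<le>n. (real k - (real n - x))\<^sup>2 * T k)
      = (\<Sum>k\<le>n. real (n - k) * (real (n - k) - 1) * T k
          + (1 - 2 * x) * (real (n - k) * T k) + x\<^sup>2 * T k)"
    by (intro sum.cong) (auto simp: of_nat_diff power2_eq_square algebra_simps)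
  also have "\<dots> = (\<Sum>k\<le>n. real (n - k) * (real (n - k) - 1) * T k)
      + (1 - 2 * x) * (\<Sum>k\<le>n. real (n - k) * T k) + x\<^sup>2 * R"
    by (simp add: sum.distrib sum_distrib_left R_def T_def row_sum_def)
  also have "\<dots> / R = x * mean_deficit g b c (n - 1) + (1 - 2 * x) * x + x\<^sup>2"
    using second_factorial_deficit[OF assms(2-4), of n] R
    by (simp add: x_def R_def T_def mean_deficit_def add_divide_distrib)
  finally show ?thesis
    by (simp add: x_def power2_eq_square algebra_simps)
qed

text \<open>For \<open>g = 0\<close> the factor \<open>0 ^ (n - k)\<close> in the closed form kills
  every entry of the row except the diagonal one.\<close>

lemma triangle_law_AE_eq:
  assumes law: "has_triangle_law M X 0 0 0 0 b c n" and "b > 0" "c \<ge> 0"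
  shows "AE \<omega> in M. X \<omega> = n"
proof -
  have "row_sum 0 b c n = (\<Sum>k\<in>{n}. triangle 0 0 0 0 b c n k)"
    unfolding row_sum_def
    by (intro sum.mono_neutral_right) (auto simp: triangle_closed_form)
  then have "\<P>(\<omega> in M. X \<omega> = n) = 1"
    using law triangle_diag_pos[OF assms(2,3), of 0 n] by (auto simp: has_triangle_law_def row_sum_def)
  moreover have "{\<omega> \<in> space M. X \<omega> = n} \<in> events"
    using law by (auto simp: has_triangle_law_def)
  ultimately show ?thesis
    by (subst (asm) prob_Collect_eq_1) auto
qed

section \<open>Conditioning the negative binomial variable on the sum\<close>

text \<open>The powers combine to \<open>b ^ k * g ^ (n - k) / (b + g) ^ n\<close> and the
  factorials to \<open>(n choose k) / fact n\<close>. All that remains besides the triangle entry is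
  independent of \<open>k\<close> and cancels under conditioning.\<close>

lemma neg_binomial_poisson_weight:
  assumes Y: "has_neg_binomial_law M Y (1 + c / b) (g / (b + g))"
    and Z: "has_poisson_law M Z (g / (b + g))"
    and "b > 0" "g > 0" "c \<ge> 0" and k: "k \<le> n"
  shows "\<P>(\<omega> in M. Y \<omega> = k) * \<P>(\<omega> in M. Z \<omega> = n - k)
    = (g / (b + g)) powr (1 + c / b) * exp (- (g / (b + g))) / ((b + g) ^ n * fact n)
      * triangle 0 0 g 0 b c n k"
proof -
  define r where "r = 1 + c / b"
  have "r > 0"
    using assms by (auto simp: r_def intro!: add_pos_nonneg)
  then have r: "r \<notin> \<int>\<^sub>\<le>\<^sub>0"
    by (auto elim!: nonpos_Ints_cases)
  \<comment> \<open>The parameter \<open>r = 1 + c / b\<close> is chosen so that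
    \<open>b * (r + i) = b * (i + 1) + c\<close>, matching the product in the closed form.\<close>
  have "b ^ k * pochhammer r k = (\<Prod>i=0..<k. b * (r + real i))"
    by (simp add: pochhammer_prod prod.distrib)
  also have "\<dots> = (\<Prod>i=0..<k. b * real (Suc i) + c)"
    using assms by (intro prod.cong) (auto simp: r_def field_simps)
  also have "\<dots> = (\<Prod>i=1..k. b * real i + c)"
    by (rule prod.reindex_bij_witness[of _ "\<lambda>i. i - 1" Suc]) auto
  finally have poch: "(\<Prod>i=1..k. b * real i + c) = b ^ k * pochhammer r k" ..
  have "1 - g / (b + g) = b / (b + g)"
    using assms by (simp add: field_simps)
  then have pY: "\<P>(\<omega> in M. Y \<omega> = k)
      = pochhammer r k / fact k * (b / (b + g)) ^ k * (g / (b + g)) powr r"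
    using Y by (simp add: has_neg_binomial_law_def r_def[symmetric] pochhammer_Gamma[OF r] add.commute)
  have pZ: "\<P>(\<omega> in M. Z \<omega> = n - k) = (g / (b + g)) ^ (n - k) / fact (n - k) * exp (- (g / (b + g)))"
    using poisson_law_prob[OF Z] assms by simp
  have ch: "real (n choose k) = fact n / (fact k * fact (n - k))"
    by (rule binomial_fact[OF k])
  have pw: "(b + g) ^ n = (b + g) ^ k * (b + g) ^ (n - k)"
    using k by (simp flip: power_add)
  show ?thesis
    unfolding pY pZ triangle_closed_form poch ch pw r_def[symmetric]
    using assms by (simp add: power_divide mult_ac)
qed

end

lemma triangle_law_eq_cond_prob:
  assumes "prob_space N" and X: "has_triangle_law M X 0 0 g 0 b c n"
    and Y: "has_neg_binomial_law N Y (1 + c / b) (g / (b + g))"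
    and Z: "has_poisson_law N Z (g / (b + g))"
    and ind: "prob_space.indep_var N (count_space UNIV) Y (count_space UNIV) Z"
    and "b > 0" "g > 0" "c \<ge> 0" and k: "k \<le> n"
  shows "\<P>(\<omega> in M. X \<omega> = k) = \<P>(\<omega> in N. Y \<omega> = k \<bar> Y \<omega> + Z \<omega> = n)"
proof -
  interpret N: prob_space N by fact
  define K where
    "K = (g / (b + g)) powr (1 + c / b) * exp (- (g / (b + g))) / ((b + g) ^ n * fact n)"
  have "K > 0"
    using assms by (auto simp: K_def intro!: divide_pos_pos mult_pos_pos)
  have w: "\<P>(\<omega> in N. Y \<omega> = j) * \<P>(\<omega> in N. Z \<omega> = n - j) = K * triangle 0 0 g 0 b c n j"
    if "j \<le> n" for j
    unfolding K_def using N.neg_binomial_poisson_weight[OF Y Z assms(6-8) that] .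
  \<comment> \<open>The constant \<open>K\<close> appears in the numerator and in every term of the
    denominator; \<open>K > 0\<close> lets it cancel.\<close>
  have "\<P>(\<omega> in N. Y \<omega> = k \<bar> Y \<omega> + Z \<omega> = n)
      = K * triangle 0 0 g 0 b c n k / (K * (\<Sum>j\<le>n. triangle 0 0 g 0 b c n j))"
    unfolding N.cond_prob_nat_add[OF ind k] using w k by (simp add: sum_distrib_left)
  also have "\<dots> = \<P>(\<omega> in M. X \<omega> = k)"
    using \<open>K > 0\<close> X k by (simp add: has_triangle_law_def)
  finally show ?thesis ..
qed

text \<open>This supplies the error \<open>e\<close> in the form \<open>a * (1 + e n)\<close>, which
  requires a nonzero limit.\<close>

lemma tendsto_relative_error:
  fixes f :: "nat \<Rightarrow> real"
  assumes "f \<longlonglongrightarrow> a" "a \<noteq> 0"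
  shows "(\<lambda>n. f n / a - 1) \<in> o(\<lambda>_. 1)"
proof -
  have "(\<lambda>n. f n / a - 1) \<longlonglongrightarrow> a / a - 1"
    by (intro tendsto_intros assms)
  then show ?thesis
    using assms(2) by (intro smalloI_tendsto) auto
qed

theorem theorem3:
  fixes \<alpha> \<beta> \<gamma> \<alpha>' \<beta>' \<gamma>' :: real
    and M :: "nat \<Rightarrow> 'a measure" and X :: "nat \<Rightarrow> 'a \<Rightarrow> nat"
    and \<mu> v :: "nat \<Rightarrow> real"
  assumes "\<alpha>' = 0" and "\<alpha> = 0" and "\<beta> = 0"
    and "\<beta>' > 0" and "\<gamma> \<ge> 0" and "\<gamma>' \<ge> 0"
    and "\<And>n. prob_space (M n)"
    and "\<And>n. has_triangle_law (M n) (X n) \<alpha> \<beta> \<gamma> \<alpha>' \<beta>' \<gamma>' n"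
    and "\<And>n. \<mu> n = prob_space.expectation (M n) (\<lambda>\<omega>. real (X n \<omega>))"
    and "\<And>n. v n = prob_space.variance (M n) (\<lambda>\<omega>. real (X n \<omega>))"
  shows
    "(\<gamma> > 0 \<longrightarrow>
       (\<forall>(N :: 'b measure) Y Z.
          prob_space N \<and>
          has_neg_binomial_law N Y (1 + \<gamma>' / \<beta>') (\<gamma> / (\<beta>' + \<gamma>)) \<and>
          has_poisson_law N Z (\<gamma> / (\<beta>' + \<gamma>)) \<and>
          prob_space.indep_var N (count_space UNIV) Y (count_space UNIV) Z \<longrightarrow>
          (\<forall>n. \<forall>k\<le>n. \<P>(\<omega> in M n. X n \<omega> = k) = \<P>(\<omega> in N. Y \<omega> = k \<bar> Y \<omega> + Z \<omega> = n))) \<and>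
       (\<exists>e :: nat \<Rightarrow> real. e \<in> o(\<lambda>_. 1) \<and> (\<forall>n. \<mu> n = real n - \<gamma> / \<beta>' * (1 + e n))) \<and>
       (\<exists>e :: nat \<Rightarrow> real. e \<in> o(\<lambda>_. 1) \<and> (\<forall>n. v n = \<gamma> / \<beta>' * (1 + e n)))) \<and>
     (\<gamma> = 0 \<longrightarrow> (\<forall>n. AE \<omega> in M n. X n \<omega> = n))"
proof -
  have law: "has_triangle_law (M n) (X n) 0 0 \<gamma> 0 \<beta>' \<gamma>' n" for n
    using assms(1-3) assms(8)[of n] by simp
  note pos = \<open>\<beta>' > 0\<close> \<open>\<gamma> \<ge> 0\<close> \<open>\<gamma>' \<ge> 0\<close>
  define x where "x = mean_deficit \<gamma> \<beta>' \<gamma>'"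
  have x: "x \<longlonglongrightarrow> \<gamma> / \<beta>'"
    unfolding x_def by (rule mean_deficit_tendsto[OF pos])
  then have x': "(\<lambda>n. x (n - 1)) \<longlonglongrightarrow> \<gamma> / \<beta>'"
    by (subst filterlim_sequentially_Suc[symmetric]) simp
  have mean: "\<mu> n = real n - x n" for n
    unfolding assms(9) x_def by (rule prob_space.triangle_law_mean[OF assms(7) law pos])
  have var: "v n = x n * x (n - 1) + x n - (x n)\<^sup>2" for n
    unfolding assms(10) x_def by (rule prob_space.triangle_law_variance[OF assms(7) law pos])
  \<comment> \<open>Since \<open>x n\<close> and \<open>x (n - 1)\<close> share a limit, the
    quadratic terms cancel and only the linear one survives.\<close>
  have "(\<lambda>n. x n * x (n - 1) + x n - (x n)\<^sup>2) \<longlonglongrightarrow> \<gamma> / \<beta>' * (\<gamma> / \<beta>') + \<gamma> / \<beta>' - (\<gamma> / \<beta>')\<^sup>2"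
    by (intro tendsto_intros x x')
  then have v: "v \<longlonglongrightarrow> \<gamma> / \<beta>'"
    by (simp add: var[abs_def] power2_eq_square)
  show ?thesis
  proof (intro conjI impI)
    assume "\<gamma> > 0"
    then have ne: "\<gamma> / \<beta>' \<noteq> 0"
      using pos by simp
    show "\<forall>(N :: 'b measure) Y Z.
          prob_space N \<and>
          has_neg_binomial_law N Y (1 + \<gamma>' / \<beta>') (\<gamma> / (\<beta>' + \<gamma>)) \<and>
          has_poisson_law N Z (\<gamma> / (\<beta>' + \<gamma>)) \<and>
          prob_space.indep_var N (count_space UNIV) Y (count_space UNIV) Z \<longrightarrow>
          (\<forall>n. \<forall>k\<le>n. \<P>(\<omega> in M n. X n \<omega> = k) = \<P>(\<omega> in N. Y \<omega> = k \<bar> Y \<omega> + Z \<omega> = n))"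
      using triangle_law_eq_cond_prob[OF _ law _ _ _ \<open>\<beta>' > 0\<close> \<open>\<gamma> > 0\<close> \<open>\<gamma>' \<ge> 0\<close>] by blast
    show "\<exists>e :: nat \<Rightarrow> real. e \<in> o(\<lambda>_. 1) \<and> (\<forall>n. \<mu> n = real n - \<gamma> / \<beta>' * (1 + e n))"
      using tendsto_relative_error[OF x ne] mean ne
      by (intro exI[of _ "\<lambda>n. x n / (\<gamma> / \<beta>') - 1"]) auto
    show "\<exists>e :: nat \<Rightarrow> real. e \<in> o(\<lambda>_. 1) \<and> (\<forall>n. v n = \<gamma> / \<beta>' * (1 + e n))"
      using tendsto_relative_error[OF v ne] ne
      by (intro exI[of _ "\<lambda>n. v n / (\<gamma> / \<beta>') - 1"]) auto
  next
    assume "\<gamma> = 0"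
    then show "\<forall>n. AE \<omega> in M n. X n \<omega> = n"
      using law pos by (auto intro: prob_space.triangle_law_AE_eq[OF assms(7)])
  qed
qed

end
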